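(* If a Radon norm on $\mathbb{R}^2$ is invariant under a linear map of $\mathbb{R}^2$ of order $4$, then the norm is Euclidean (i.e. induced by an inner product).
   Context: A norm $\|\cdot\|$ on $\mathbb{R}^2$ is called a Radon norm if the Birkhoff orthogonality relation is symmetric, where $x$ is Birkhoff orthogonal to $y$ if $\|x+ty\|\ge\|x\|$ for all $t\in\mathbb{R}$. The norm is invariant under a linear map $A$ if $\|Ax\|=\|x\|$ for all $x$. A linear map $A$ has order $4$ if $4$ is the least positive integer $j$ with $A^j=I$. *)

theory Defs
  imports "HOL-Analysis.Analysis"
begin

definition is_norm :: "('a::real_vector \<Rightarrow> real) \<Rightarrow> bool" where
  "is_norm N \<longleftrightarrow>
     (\<forall>x. 0 \<le> N x) \<and>
     (\<forall>x. N x = 0 \<longleftrightarrow> x = 0) \<and>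
     (\<forall>c x. N (c *\<^sub>R x) = \<bar>c\<bar> * N x) \<and>
     (\<forall>x y. N (x + y) \<le> N x + N y)"

definition birkhoff_orthogonal :: "('a::real_vector \<Rightarrow> real) \<Rightarrow> 'a \<Rightarrow> 'a \<Rightarrow> bool" where
  "birkhoff_orthogonal N x y \<longleftrightarrow> (\<forall>t. N (x + t *\<^sub>R y) \<ge> N x)"

definition radon_norm :: "('a::real_vector \<Rightarrow> real) \<Rightarrow> bool" where
  "radon_norm N \<longleftrightarrow> is_norm N \<and> symp (birkhoff_orthogonal N)"

definition norm_invariant_under :: "('a \<Rightarrow> real) \<Rightarrow> ('a \<Rightarrow> 'a) \<Rightarrow> bool" where
  "norm_invariant_under N A \<longleftrightarrow> (\<forall>x. N (A x) = N x)"

definition map_has_order :: "('a \<Rightarrow> 'a) \<Rightarrow> nat \<Rightarrow> bool" where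
  "map_has_order A n \<longleftrightarrow>
     0 < n \<and> A ^^ n = id \<and> (\<forall>j. 0 < j \<and> A ^^ j = id \<longrightarrow> n \<le> j)"

definition is_inner_product :: "('a::real_vector \<Rightarrow> 'a \<Rightarrow> real) \<Rightarrow> bool" where
  "is_inner_product B \<longleftrightarrow>
     bilinear B \<and> (\<forall>x y. B x y = B y x) \<and> (\<forall>x. x \<noteq> 0 \<longrightarrow> 0 < B x x)"

text \<open>Induced by an arbitrary inner product, not necessarily the standard one of the type.\<close>

definition euclidean_norm :: "('a::real_vector \<Rightarrow> real) \<Rightarrow> bool" where
  "euclidean_norm N \<longleftrightarrow> (\<exists>B. is_inner_product B \<and> (\<forall>x. N x = sqrt (B x x)))"

end

theory Submission
  imports Defs
begin

text \<open>
  Write \<open>\<omega>\<close> for the standard area form on the plane and let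
  \<open>P y = sup\<^sub>v \<bar>\<omega> v y\<bar> / N v\<close> be the dual norm of \<open>N\<close>, carried back to the plane by \<open>\<omega>\<close>.
  A nonzero \<open>x\<close> is Birkhoff orthogonal to \<open>y\<close> exactly when this supremum is attained at \<open>x\<close>.

  For a Radon norm, \<open>P\<close> is a constant multiple of \<open>N\<close> (\<open>radon_symplectic_dual\<close>). Indeed, every
  nonzero \<open>y\<close> has a nonzero \<open>x\<close> with \<open>x\<close> and \<open>y\<close> orthogonal in both orders. Then \<open>\<omega> x\<close> is, up to
  scaling, a supporting functional at \<open>y\<close> both for \<open>N\<close> and for \<open>P\<close>. So along any line that
  avoids the origin, \<open>N\<close> and \<open>P\<close> have the same logarithmic slopes, which forces \<open>P / N\<close> to be
  constant there (\<open>common_support_ratio_constant\<close>).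

  A linear map \<open>A\<close> of order 4 of the plane satisfies \<open>A\<^sup>2 = - I\<close>, so, after rescaling \<open>\<omega>\<close>, the form
  \<open>B x y = \<omega> x (A y)\<close> is an inner product (\<open>complex_structure_inner_product\<close>). As \<open>N\<close> is
  \<open>A\<close>-invariant, \<open>P = k N\<close> says that \<open>N\<close> is, up to the factor \<open>k\<close>, its own dual norm with
  respect to \<open>B\<close>. The only self-dual norm is the Euclidean one: \<open>B x x \<le> k (N x)\<^sup>2\<close> by duality,
  and if \<open>w\<close> attains the supremum that defines the dual norm at \<open>x\<close>, the Cauchy-Schwarz inequality
  gives \<open>(k N x N w)\<^sup>2 = (B x w)\<^sup>2 \<le> B x x B w w \<le> B x x k (N w)\<^sup>2\<close>, the converse inequality.
\<close>

section \<open>Functions with common supporting slopes\<close>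

text \<open>
  Subdividing the interval into \<open>n\<close> equal pieces and adding up the hypothesis over them gains a
  factor \<open>1 / n\<close>, since the increments of \<open>b\<close> telescope.
\<close>

lemma eq_if_increment_le_product:
  fixes R b :: "real \<Rightarrow> real"
  assumes "a \<le> c"
    and inc: "\<And>s t. a \<le> s \<Longrightarrow> s \<le> t \<Longrightarrow> t \<le> c \<Longrightarrow> \<bar>R t - R s\<bar> \<le> (t - s) * (b t - b s)"
  shows "R c = R a"
proof (rule ccontr)
  assume "R c \<noteq> R a"
  then have gap: "\<bar>R c - R a\<bar> > 0" by simp
  define K where "K = (c - a) * (b c - b a)"
  obtain n :: nat where n: "K < real n * \<bar>R c - R a\<bar>"
    using reals_Archimedean3[OF gap] by blast
  have "0 \<le> K" using inc[of a c] \<open>a \<le> c\<close> unfolding K_def by auto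
  then have n0: "n > 0" using n by (cases n) auto
  define h where "h = (c - a) / real n"
  have h: "h \<ge> 0" "real n * h = c - a" using \<open>a \<le> c\<close> n0 by (auto simp: h_def)
  have "\<bar>R (a + real k * h) - R a\<bar> \<le> h * (b (a + real k * h) - b a)" if "k \<le> n" for k
    using that
  proof (induction k)
    case 0
    then show ?case by simp
  next
    case (Suc k)
    have "real (Suc k) * h \<le> real n * h" using Suc.prems h(1) by (intro mult_right_mono) auto
    then have "\<bar>R (a + real (Suc k) * h) - R (a + real k * h)\<bar>
        \<le> ((a + real (Suc k) * h) - (a + real k * h)) * (b (a + real (Suc k) * h) - b (a + real k * h))"
      using h by (intro inc) (auto simp: algebra_simps)
    also have "(a + real (Suc k) * h) - (a + real k * h) = h" by (simp add: algebra_simps)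
    finally show ?case using Suc by (simp add: right_diff_distrib)
  qed
  from this[of n] have "\<bar>R c - R a\<bar> \<le> h * (b c - b a)" using h(2) by simp
  then have "real n * \<bar>R c - R a\<bar> \<le> real n * (h * (b c - b a))" by (intro mult_left_mono) auto
  also have "\<dots> = K" using h(2) unfolding K_def by (metis mult.assoc)
  finally show False using n by simp
qed

text \<open>
  Both functions are convex with logarithmic slope \<open>m\<close>, so formally \<open>(ln (G / F))' = 0\<close>. Since they
  need not be differentiable, the increments of \<open>G / F\<close> are estimated directly: they are at
  most a constant multiple of \<open>t - s\<close> times the increment of the slope \<open>G m\<close> of \<open>G\<close>.
\<close>

lemma common_support_ratio_constant:
  fixes F G m :: "real \<Rightarrow> real"
  assumes L: "0 < L" "\<And>t. L \<le> F t"
    and G0: "\<And>t. 0 \<le> G t"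
    and F: "\<And>s t. F t * (1 + m t * (s - t)) \<le> F s"
    and G: "\<And>s t. G t * (1 + m t * (s - t)) \<le> G s"
    and "a \<le> c"
  shows "G c / F c = G a / F a"
proof (rule eq_if_increment_le_product[where R = "\<lambda>t. G t / F t" and b = "\<lambda>t. G t * m t / L"])
  fix s t :: real
  have pos: "F s > 0" "F t > 0" using L less_le_trans by blast+
  define d where "d = (t - s) * (G t * m t - G s * m s)"
  have Gs: "G s * m s * (t - s) \<le> G t - G s" and Gt: "G t - G s \<le> G t * m t * (t - s)"
    using G[of s t] G[of t s] by (auto simp: algebra_simps)
  have Fs: "F s * m s * (t - s) \<le> F t - F s" and Ft: "F t - F s \<le> F t * m t * (t - s)"
    using F[of s t] F[of t s] by (auto simp: algebra_simps)
  have d0: "0 \<le> d" using Gs Gt by (simp add: d_def algebra_simps)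
  have "G t * F s - G s * F t = (G t - G s) * F s - G s * (F t - F s)" by algebra
  also have "\<dots> \<le> (G t * m t * (t - s)) * F s - G s * (F s * m s * (t - s))"
    using Gt Fs pos G0[of s] by (intro diff_mono mult_right_mono mult_left_mono) auto
  also have "\<dots> = d * F s" by (simp add: d_def algebra_simps)
  finally have 1: "G t * F s - G s * F t \<le> d * F s" .
  have "G s * F t - G t * F s = G t * (F t - F s) - (G t - G s) * F t" by algebra
  also have "\<dots> \<le> G t * (F t * m t * (t - s)) - (G s * m s * (t - s)) * F t"
    using Gs Ft pos G0[of t] by (intro diff_mono mult_right_mono mult_left_mono) auto
  also have "\<dots> = d * F t" by (simp add: d_def algebra_simps)
  finally have 2: "G s * F t - G t * F s \<le> d * F t" .
  have "G t / F t - G s / F s \<le> d / F t" "G s / F s - G t / F t \<le> d / F s"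
    using 1 2 pos divide_right_mono[OF 1, of "F s * F t"] divide_right_mono[OF 2, of "F s * F t"]
    by (simp_all add: diff_divide_distrib mult.commute)
  moreover have "d / F t \<le> d / L" "d / F s \<le> d / L"
    using L d0 pos by (auto intro!: divide_left_mono)
  ultimately have "\<bar>G t / F t - G s / F s\<bar> \<le> d / L" by linarith
  then show "\<bar>G t / F t - G s / F s\<bar> \<le> (t - s) * (G t * m t / L - G s * m s / L)"
    by (simp add: d_def flip: diff_divide_distrib)
qed fact

section \<open>The area form\<close>

definition area :: "real ^ 2 \<Rightarrow> real ^ 2 \<Rightarrow> real" where
  "area x y = x $ 1 * y $ 2 - x $ 2 * y $ 1"

lemma area_add: "area (x + y) z = area x z + area y z" "area z (x + y) = area z x + area z y"
  and area_scale: "area (r *\<^sub>R x) z = r * area x z" "area z (r *\<^sub>R x) = r * area z x"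
  and area_zero: "area 0 z = 0" "area z 0 = 0"
  and area_self: "area x x = 0"
  and area_swap: "area y x = - area x y"
  by (auto simp: area_def algebra_simps)

lemma area_cramer: "area x y *\<^sub>R v = area v y *\<^sub>R x + area x v *\<^sub>R y"
  by (auto simp: area_def vec_eq_iff forall_2 algebra_simps)

lemma exists_area_nonzero:
  assumes "x \<noteq> 0"
  shows "\<exists>y. area x y \<noteq> 0"
proof -
  have "x $ 1 \<noteq> 0 \<or> x $ 2 \<noteq> 0" using assms by (auto simp: vec_eq_iff forall_2)
  then have "area x (vector [- x $ 2, x $ 1]) \<noteq> 0"
    by (auto simp: area_def sum_squares_eq_zero_iff simp flip: power2_eq_square)
  then show ?thesis ..
qed

lemma area_zero_imp_parallel:
  assumes "x \<noteq> 0" "area x y = 0"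
  obtains r where "y = r *\<^sub>R x"
proof -
  obtain z where z: "area x z \<noteq> 0" using exists_area_nonzero[OF assms(1)] by blast
  have "area x z *\<^sub>R y = area y z *\<^sub>R x" using area_cramer[of x z y] assms(2) by simp
  then have "y = (area y z / area x z) *\<^sub>R x" using z
    by (metis divide_inverse_commute scaleR_scaleR scaleR_one left_inverse)
  then show ?thesis ..
qed

section \<open>Birkhoff orthogonality in the plane\<close>

lemma
  assumes "is_norm N"
  shows is_norm_nonneg: "0 \<le> N x"
    and is_norm_eq_zero: "N x = 0 \<longleftrightarrow> x = 0"
    and is_norm_scale: "N (r *\<^sub>R x) = \<bar>r\<bar> * N x"
    and is_norm_triangle: "N (x + y) \<le> N x + N y"
  using assms unfolding is_norm_def by blast+

lemma is_norm_pos: "is_norm N \<Longrightarrow> x \<noteq> 0 \<Longrightarrow> 0 < N x"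
  by (metis is_norm_eq_zero is_norm_nonneg order_le_less)

lemma is_norm_diff:
  assumes "is_norm N"
  shows "N x - N y \<le> N (x - y)"
  using is_norm_triangle[OF assms, of "x - y" y] by simp

lemma norm_minimum_on_line:
  assumes "is_norm N" "y \<noteq> 0"
  shows "\<exists>t. \<forall>s. N (x + t *\<^sub>R y) \<le> N (x + s *\<^sub>R y)"
proof -
  have y: "N y > 0" using assms is_norm_pos by blast
  \<comment> \<open>outside \<open>[-T, T]\<close> the norm exceeds its value at the parameter 0\<close>
  define T where "T = 2 * N x / N y"
  have T: "T \<ge> 0" using y is_norm_nonneg[OF assms(1)] by (simp add: T_def)
  have lip: "N (x + s *\<^sub>R y) - N (x + t *\<^sub>R y) \<le> N y * \<bar>s - t\<bar>" for s t
    using is_norm_diff[OF assms(1), of "x + s *\<^sub>R y" "x + t *\<^sub>R y"] is_norm_scale[OF assms(1), of "s - t" y]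
    by (simp add: algebra_simps)
  have "(N y)-lipschitz_on {-T..T} (\<lambda>s. N (x + s *\<^sub>R y))"
  proof (rule lipschitz_onI)
    fix s t
    show "dist (N (x + s *\<^sub>R y)) (N (x + t *\<^sub>R y)) \<le> N y * dist s t"
      using lip[of s t] lip[of t s] by (auto simp: dist_real_def abs_minus_commute)
  qed (use y in auto)
  then have "continuous_on {-T..T} (\<lambda>s. N (x + s *\<^sub>R y))" by (rule lipschitz_on_continuous_on)
  then obtain t where t: "\<And>s. s \<in> {-T..T} \<Longrightarrow> N (x + t *\<^sub>R y) \<le> N (x + s *\<^sub>R y)"
    using continuous_attains_inf[of "{-T..T}" "\<lambda>s. N (x + s *\<^sub>R y)"] T by force
  have "N (x + t *\<^sub>R y) \<le> N (x + s *\<^sub>R y)" if "s \<notin> {-T..T}" for s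
  proof -
    have "T < \<bar>s\<bar>" using that by auto
    then have "2 * N x < \<bar>s\<bar> * N y" using y by (simp add: T_def field_simps)
    moreover have "\<bar>s\<bar> * N y - N x \<le> N (x + s *\<^sub>R y)"
      using is_norm_triangle[OF assms(1), of "x + s *\<^sub>R y" "(-1) *\<^sub>R x"] is_norm_scale[OF assms(1), of "-1" x]
        is_norm_scale[OF assms(1), of s y]
      by simp
    moreover have "N (x + t *\<^sub>R y) \<le> N x" using t[of 0] T by simp
    ultimately show ?thesis by linarith
  qed
  with t show ?thesis by blast
qed

text \<open>The foot of a shortest segment from a point off the line \<open>\<real> y\<close> to that line.\<close>

lemma exists_birkhoff_orthogonal:
  fixes y :: "real ^ 2"
  assumes "is_norm N" "y \<noteq> 0"
  obtains x where "x \<noteq> 0" "birkhoff_orthogonal N x y"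
proof -
  obtain z where z: "area y z \<noteq> 0" using exists_area_nonzero[OF assms(2)] by blast
  obtain t where t: "\<And>s. N (z + t *\<^sub>R y) \<le> N (z + s *\<^sub>R y)"
    using norm_minimum_on_line[OF assms] by blast
  have "area y (z + t *\<^sub>R y) \<noteq> 0" using z by (simp add: area_add area_scale area_self)
  then have "z + t *\<^sub>R y \<noteq> 0" by (metis area_zero(2))
  moreover have "birkhoff_orthogonal N (z + t *\<^sub>R y) y"
    unfolding birkhoff_orthogonal_def using t by (metis add.assoc scaleR_add_left)
  ultimately show ?thesis ..
qed

lemma birkhoff_orthogonal_area:
  assumes "is_norm N" "birkhoff_orthogonal N x y" "x \<noteq> 0" "y \<noteq> 0"
  shows "area x y \<noteq> 0"
proof
  assume "area x y = 0"
  then obtain r where r: "y = r *\<^sub>R x" using area_zero_imp_parallel assms(3) by blast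
  then have "x + (- (1 / r)) *\<^sub>R y = 0" using assms(4) by auto
  then have "N x \<le> 0"
    using assms(2) is_norm_eq_zero[OF assms(1)] unfolding birkhoff_orthogonal_def by metis
  then show False using is_norm_pos[OF assms(1,3)] by simp
qed

text \<open>
  Orthogonality says that the projection to \<open>\<real> x\<close> along \<open>y\<close> does not increase the norm; Cramer's
  rule identifies this projection.
\<close>

lemma birkhoff_orthogonal_maximizes_area:
  assumes "is_norm N" "birkhoff_orthogonal N x y"
  shows "\<bar>area v y\<bar> * N x \<le> \<bar>area x y\<bar> * N v"
proof -
  define r where "r = area v y"
  have "\<bar>r\<bar> * N x \<le> N (r *\<^sub>R x + area x v *\<^sub>R y)"
  proof (cases "r = 0")
    case True
    then show ?thesis using is_norm_nonneg[OF assms(1)] by simp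
  next
    case False
    then have "r *\<^sub>R x + area x v *\<^sub>R y = r *\<^sub>R (x + (area x v / r) *\<^sub>R y)"
      by (simp add: scaleR_add_right)
    moreover have "N x \<le> N (x + (area x v / r) *\<^sub>R y)"
      using assms(2) unfolding birkhoff_orthogonal_def by blast
    ultimately show ?thesis by (simp add: is_norm_scale[OF assms(1)] mult_left_mono)
  qed
  also have "\<dots> = \<bar>area x y\<bar> * N v"
    unfolding r_def area_cramer[symmetric] by (rule is_norm_scale[OF assms(1)])
  finally show ?thesis by (simp add: r_def)
qed

section \<open>Radon norms are multiples of their symplectic dual norm\<close>

text \<open>The vector 0 contributes the value \<open>0 / 0 = 0\<close>, so the supremum may range over all vectors.\<close>

definition symplectic_dual :: "(real ^ 2 \<Rightarrow> real) \<Rightarrow> real ^ 2 \<Rightarrow> real" where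
  "symplectic_dual N y = (SUP v. \<bar>area v y\<bar> / N v)"

lemma symplectic_dual_orthogonal:
  assumes "is_norm N" "birkhoff_orthogonal N x y" "x \<noteq> 0"
  shows "symplectic_dual N y = \<bar>area x y\<bar> / N x"
  unfolding symplectic_dual_def
proof (rule cSup_eq_maximum)
  fix q assume "q \<in> range (\<lambda>v. \<bar>area v y\<bar> / N v)"
  then obtain v where q: "q = \<bar>area v y\<bar> / N v" by blast
  have x: "N x > 0" using assms is_norm_pos by blast
  show "q \<le> \<bar>area x y\<bar> / N x"
  proof (cases "v = 0")
    case True
    then show ?thesis using x by (simp add: q area_def)
  next
    case False
    then show ?thesis
      using birkhoff_orthogonal_maximizes_area[OF assms(1,2), of v] is_norm_pos[OF assms(1), of v] x
      by (simp add: q field_simps)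
  qed
qed blast

lemma symplectic_dual_nonneg:
  assumes "is_norm N" "y \<noteq> 0"
  shows "0 \<le> symplectic_dual N y"
proof -
  obtain x where "x \<noteq> 0" "birkhoff_orthogonal N x y"
    using exists_birkhoff_orthogonal[OF assms] .
  then show ?thesis
    using symplectic_dual_orthogonal[OF assms(1)] is_norm_nonneg[OF assms(1)] by simp
qed

lemma area_le_symplectic_dual:
  assumes "is_norm N" "y \<noteq> 0"
  shows "\<bar>area v y\<bar> \<le> N v * symplectic_dual N y"
proof -
  obtain x where x: "x \<noteq> 0" "birkhoff_orthogonal N x y"
    using exists_birkhoff_orthogonal[OF assms] .
  show ?thesis
    using birkhoff_orthogonal_maximizes_area[OF assms(1) x(2), of v] is_norm_pos[OF assms(1) x(1)]
    by (simp add: symplectic_dual_orthogonal[OF assms(1) x(2,1)] field_simps)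
qed

lemma radon_norm_is_norm: "radon_norm N \<Longrightarrow> is_norm N"
  by (simp add: radon_norm_def)

lemma radon_norm_sym:
  "radon_norm N \<Longrightarrow> birkhoff_orthogonal N x y \<Longrightarrow> birkhoff_orthogonal N y x"
  unfolding radon_norm_def by (blast dest: sympD)

text \<open>
  A vector orthogonal to \<open>y\<close> in both orders supports both norms at \<open>y\<close>. The slope \<open>m\<close> is that of
  the functional \<open>v \<mapsto> area v x / area y x\<close>, which equals 1 at \<open>y\<close>, in the direction \<open>q\<close>.
\<close>

lemma radon_common_support:
  assumes "radon_norm N" "y \<noteq> 0" "\<And>s. y + s *\<^sub>R q \<noteq> 0"
  shows "\<exists>m. \<forall>s. N y * (1 + m * s) \<le> N (y + s *\<^sub>R q) \<and>
    symplectic_dual N y * (1 + m * s) \<le> symplectic_dual N (y + s *\<^sub>R q)"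
proof -
  have N: "is_norm N" using assms(1) by (rule radon_norm_is_norm)
  obtain x where x: "x \<noteq> 0" and xy: "birkhoff_orthogonal N x y"
    using exists_birkhoff_orthogonal[OF N assms(2)] .
  have yx: "birkhoff_orthogonal N y x" using radon_norm_sym[OF assms(1) xy] .
  have a: "area y x \<noteq> 0" using birkhoff_orthogonal_area[OF N yx assms(2) x] .
  have pos: "N x > 0" "N y > 0" using x assms(2) is_norm_pos[OF N] by auto
  define m where "m = area q x / area y x"
  have "N y * (1 + m * s) \<le> N (y + s *\<^sub>R q) \<and>
      symplectic_dual N y * (1 + m * s) \<le> symplectic_dual N (y + s *\<^sub>R q)" for s
  proof -
    define v where "v = y + s *\<^sub>R q"
    have "1 + m * s = area v x / area y x"
      using a by (simp add: m_def v_def area_add area_scale field_simps)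
    also have "\<dots> \<le> \<bar>area v x\<bar> / \<bar>area y x\<bar>" by (metis abs_divide abs_ge_self)
    finally have le: "1 + m * s \<le> \<bar>area v x\<bar> / \<bar>area y x\<bar>" .
    have "N y * (1 + m * s) \<le> N y * (\<bar>area v x\<bar> / \<bar>area y x\<bar>)"
      using le pos by (intro mult_left_mono) auto
    also have "\<dots> \<le> N v"
      using birkhoff_orthogonal_maximizes_area[OF N yx, of v] a by (simp add: field_simps)
    finally have 1: "N y * (1 + m * s) \<le> N v" .
    have Py: "symplectic_dual N y = \<bar>area y x\<bar> / N x"
      using symplectic_dual_orthogonal[OF N xy x] by (simp add: area_swap[of x y])
    have "symplectic_dual N y * (1 + m * s) \<le> (\<bar>area y x\<bar> / N x) * (\<bar>area v x\<bar> / \<bar>area y x\<bar>)"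
      unfolding Py using le pos by (intro mult_left_mono) auto
    also have "\<dots> = \<bar>area x v\<bar> / N x" using a by (simp add: area_swap[of x v])
    also have "\<dots> \<le> symplectic_dual N v"
      using area_le_symplectic_dual[OF N, of v x] assms(3)[of s] pos by (simp add: v_def field_simps)
    finally show ?thesis using 1 by (simp add: v_def)
  qed
  then show ?thesis by blast
qed

lemma radon_ratio_eq:
  assumes "radon_norm N" "area x y \<noteq> 0"
  shows "symplectic_dual N y / N y = symplectic_dual N x / N x"
proof -
  have N: "is_norm N" using assms(1) by (rule radon_norm_is_norm)
  define q where "q = y - x"
  have aq: "area (x + t *\<^sub>R q) q = area x y" for t
    by (simp add: q_def area_def algebra_simps)
  have nz: "x + t *\<^sub>R q \<noteq> 0" for t using aq[of t] assms(2) by (metis area_zero(1))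
  have q: "q \<noteq> 0" using aq[of 0] assms(2) by (metis area_zero(2))
  obtain t0 where t0: "\<And>s. N (x + t0 *\<^sub>R q) \<le> N (x + s *\<^sub>R q)"
    using norm_minimum_on_line[OF N q] by blast
  have shift: "(x + t *\<^sub>R q) + (s - t) *\<^sub>R q = x + s *\<^sub>R q" for s t
    by (simp add: algebra_simps)
  have "\<exists>m. \<forall>s. N (x + t *\<^sub>R q) * (1 + m * (s - t)) \<le> N (x + s *\<^sub>R q) \<and>
    symplectic_dual N (x + t *\<^sub>R q) * (1 + m * (s - t)) \<le> symplectic_dual N (x + s *\<^sub>R q)" for t
  proof -
    have "(x + t *\<^sub>R q) + s *\<^sub>R q \<noteq> 0" for s
      using nz[of "t + s"] by (simp add: scaleR_add_left add.assoc)
    from radon_common_support[OF assms(1) nz this] show ?thesis by (metis shift)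
  qed
  then obtain m where m: "\<And>s t. N (x + t *\<^sub>R q) * (1 + m t * (s - t)) \<le> N (x + s *\<^sub>R q)"
    "\<And>s t. symplectic_dual N (x + t *\<^sub>R q) * (1 + m t * (s - t)) \<le> symplectic_dual N (x + s *\<^sub>R q)"
    by metis
  have "symplectic_dual N (x + 1 *\<^sub>R q) / N (x + 1 *\<^sub>R q)
      = symplectic_dual N (x + 0 *\<^sub>R q) / N (x + 0 *\<^sub>R q)"
    using common_support_ratio_constant[where F = "\<lambda>t. N (x + t *\<^sub>R q)"
      and G = "\<lambda>t. symplectic_dual N (x + t *\<^sub>R q)" and a = 0 and c = 1,
      OF is_norm_pos[OF N nz[of t0]] t0 symplectic_dual_nonneg[OF N nz] m]
    by simp
  then show ?thesis by (simp add: q_def)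
qed

theorem radon_symplectic_dual:
  assumes "radon_norm N"
  obtains k where "0 < k" "\<And>y. y \<noteq> 0 \<Longrightarrow> symplectic_dual N y = k * N y"
proof -
  have N: "is_norm N" using assms by (rule radon_norm_is_norm)
  define e :: "real ^ 2" where "e = axis 1 1"
  have e: "e \<noteq> 0" by (simp add: e_def axis_eq_0_iff)
  define k where "k = symplectic_dual N e / N e"
  have k: "symplectic_dual N y / N y = k" if "y \<noteq> 0" for y
  proof (cases "area e y = 0")
    case True
    then obtain r where r: "y = r *\<^sub>R e" using area_zero_imp_parallel[OF e] by blast
    \<comment> \<open>parallel vectors lie on no common line off the origin, so a third direction links them\<close>
    obtain z where z: "area e z \<noteq> 0" using exists_area_nonzero[OF e] by blast
    then have "area y z \<noteq> 0" using that r by (auto simp: area_scale)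
    then show ?thesis
      using radon_ratio_eq[OF assms z] radon_ratio_eq[OF assms, of y z] by (simp add: k_def)
  next
    case False
    then show ?thesis using radon_ratio_eq[OF assms] by (simp add: k_def)
  qed
  obtain x where x: "x \<noteq> 0" "birkhoff_orthogonal N x e"
    using exists_birkhoff_orthogonal[OF N e] .
  have "0 < k"
    using birkhoff_orthogonal_area[OF N x(2,1) e] is_norm_pos[OF N] x(1) e
    by (simp add: k_def symplectic_dual_orthogonal[OF N x(2,1)])
  moreover have "symplectic_dual N y = k * N y" if "y \<noteq> 0" for y
    using k[OF that] is_norm_pos[OF N that] by (simp add: field_simps)
  ultimately show ?thesis ..
qed

section \<open>Linear maps of order four\<close>

text \<open>
  Some \<open>u\<close> satisfies \<open>A\<^sup>2 u = - u\<close>, namely any nonzero vector \<open>x - A\<^sup>2 x\<close>, and so does \<open>A u\<close>. These two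
  vectors are independent, since \<open>A u = r u\<close> would give \<open>r\<^sup>2 = - 1\<close>.
\<close>

lemma order_four_basis:
  fixes A :: "real ^ 2 \<Rightarrow> real ^ 2"
  assumes "linear A" "map_has_order A 4"
  obtains u where "area u (A u) \<noteq> 0" "A (A u) = - u"
proof -
  interpret linear A by fact
  have "A ^^ 4 = id" and min: "\<And>j. 0 < j \<Longrightarrow> A ^^ j = id \<Longrightarrow> 4 \<le> j"
    using assms(2) unfolding map_has_order_def by blast+
  have "A ^^ 2 \<noteq> id" using min[of 2] by auto
  from \<open>A ^^ 4 = id\<close> have A4: "A (A (A (A x))) = x" for x
    by (simp add: numeral_eq_Suc fun_eq_iff)
  obtain x where x: "A (A x) \<noteq> x" using \<open>A ^^ 2 \<noteq> id\<close> by (auto simp: numeral_eq_Suc fun_eq_iff)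
  define u where "u = x - A (A x)"
  have u: "u \<noteq> 0" using x by (simp add: u_def)
  have AA: "A (A u) = - u" by (simp add: u_def diff A4)
  have "area u (A u) \<noteq> 0"
  proof
    assume "area u (A u) = 0"
    then obtain r where r: "A u = r *\<^sub>R u" using area_zero_imp_parallel[OF u] by blast
    then have "A (A u) = (r * r) *\<^sub>R u" by (simp add: scale)
    then have "(r * r) *\<^sub>R u = - u" using AA by metis
    then have "(r * r + 1) *\<^sub>R u = 0" by (simp add: scaleR_add_left)
    then have "r * r + 1 = 0" using u by simp
    then show False by (smt (verit) zero_le_square)
  qed
  then show ?thesis using AA that by blast
qed

text \<open>In the basis \<open>u\<close>, \<open>A u\<close>, the map \<open>A\<close> is the quarter turn and the form is the dot product.\<close>

lemma complex_structure_inner_product: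
  fixes A :: "real ^ 2 \<Rightarrow> real ^ 2"
  assumes "linear A" and u: "area u (A u) \<noteq> 0" "A (A u) = - u"
  shows "is_inner_product (\<lambda>x y. area x (A y) / area u (A u))" (is "is_inner_product ?B")
    and "A (A x) = - x"
proof -
  interpret linear A by fact
  define w where "w = A u"
  define D where "D = area u w"
  have D: "D \<noteq> 0" using u by (simp add: D_def w_def)
  have coords: "\<exists>a b. x = a *\<^sub>R u + b *\<^sub>R w" for x
  proof -
    have "x = (1 / D) *\<^sub>R (D *\<^sub>R x)" using D by simp
    also have "\<dots> = (area x w / D) *\<^sub>R u + (area u x / D) *\<^sub>R w"
      unfolding D_def area_cramer[of u w x] by (simp add: scaleR_add_right)
    finally show ?thesis by blast
  qed
  have A: "A (a *\<^sub>R u + b *\<^sub>R w) = a *\<^sub>R w + (- b) *\<^sub>R u" for a b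
    using u by (simp add: add scale w_def)
  have B: "?B (a *\<^sub>R u + b *\<^sub>R w) (c *\<^sub>R u + d *\<^sub>R w) = a * c + b * d" for a b c d
    using D unfolding A area_add area_scale area_self area_swap[of w u] w_def[symmetric] D_def[symmetric]
    by (simp add: field_simps)
  have "bilinear ?B"
    by (auto simp: bilinear_def linear_iff add scale area_add area_scale add_divide_distrib)
  moreover have "?B x y = ?B y x" for x y
  proof -
    obtain a b c d where "x = a *\<^sub>R u + b *\<^sub>R w" "y = c *\<^sub>R u + d *\<^sub>R w"
      using coords by metis
    then show ?thesis using B[of a b c d] B[of c d a b] by (simp only: mult.commute)
  qed
  moreover have "0 < ?B x x" if x0: "x \<noteq> 0" for x
  proof -
    obtain a b where x: "x = a *\<^sub>R u + b *\<^sub>R w" using coords by blast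
    then have "a \<noteq> 0 \<or> b \<noteq> 0" using x0 by auto
    then show ?thesis unfolding x B by (simp add: sum_squares_gt_zero_iff)
  qed
  ultimately show "is_inner_product ?B" unfolding is_inner_product_def by blast
  obtain a b where "x = a *\<^sub>R u + b *\<^sub>R w" using coords by blast
  then show "A (A x) = - x" using u(2) by (simp add: w_def add scale diff neg)
qed

lemma inner_product_scale:
  assumes "is_inner_product B" "0 < r"
  shows "is_inner_product (\<lambda>x y. r * B x y)"
  using assms
  by (auto simp: is_inner_product_def bilinear_def linear_iff distrib_left mult.left_commute)

lemma inner_product_cauchy_schwarz:
  assumes "is_inner_product B"
  shows "(B x y)\<^sup>2 \<le> B x x * B y y"
proof (cases "y = 0")
  case True
  then show ?thesis using assms by (simp add: is_inner_product_def bilinear_lzero bilinear_rzero)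
next
  case False
  have bl: "bilinear B" and sym: "B y x = B x y" and pos: "B y y > 0"
    using assms False by (auto simp: is_inner_product_def)
  have nonneg: "0 \<le> B z z" for z
    using assms by (cases "z = 0") (auto simp: is_inner_product_def bilinear_rzero less_imp_le)
  have "B (B y y *\<^sub>R x - B x y *\<^sub>R y) (B y y *\<^sub>R x - B x y *\<^sub>R y) = B y y * (B x x * B y y - (B x y)\<^sup>2)"
    by (simp add: bilinear_lsub[OF bl] bilinear_rsub[OF bl] bilinear_lmul[OF bl] bilinear_rmul[OF bl] sym)
      (simp add: algebra_simps power2_eq_square)
  then show ?thesis using nonneg[of "B y y *\<^sub>R x - B x y *\<^sub>R y"] pos
    by (simp add: zero_le_mult_iff)
qed

section \<open>Invariant Radon norms\<close>

theorem corollary1: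
  fixes N :: "real ^ 2 \<Rightarrow> real"
    and A :: "real ^ 2 \<Rightarrow> real ^ 2"
  assumes "radon_norm N"
    and "linear A"
    and "map_has_order A 4"
    and "norm_invariant_under N A"
  shows "euclidean_norm N"
proof -
  have N: "is_norm N" using assms(1) by (rule radon_norm_is_norm)
  have inv: "N (A x) = N x" for x using assms(4) by (simp add: norm_invariant_under_def)
  have Anz: "A x \<noteq> 0" if "x \<noteq> 0" for x
    using that by (metis inv is_norm_eq_zero[OF N])
  obtain k where k: "0 < k" "\<And>y. y \<noteq> 0 \<Longrightarrow> symplectic_dual N y = k * N y"
    using radon_symplectic_dual[OF assms(1)] by blast
  obtain u where u: "area u (A u) \<noteq> 0" "A (A u) = - u"
    using order_four_basis[OF assms(2,3)] .
  define B where "B = (\<lambda>x y. area x (A y) / area u (A u))"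
  have B: "is_inner_product B"
    unfolding B_def by (rule complex_structure_inner_product(1)[OF assms(2) u])
  have AA: "A (A x) = - x" for x by (rule complex_structure_inner_product(2)[OF assms(2) u])
  define l where "l = k / \<bar>area u (A u)\<bar>"
  have l: "0 < l" using k u by (simp add: l_def)
  have upper: "B x x \<le> l * (N x)\<^sup>2" for x
  proof (cases "x = 0")
    case True
    then show ?thesis using l by (simp add: B_def area_def)
  next
    case False
    then have "\<bar>area x (A x)\<bar> \<le> N x * (k * N x)"
      using area_le_symplectic_dual[OF N Anz, of x x] k(2)[OF Anz, of x] by (simp add: inv)
    then have "\<bar>B x x\<bar> \<le> l * (N x)\<^sup>2"
      using u by (simp add: B_def l_def abs_divide divide_right_mono power2_eq_square mult_ac)
    then show ?thesis by linarith
  qed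
  have lower: "l * (N x)\<^sup>2 \<le> B x x" if x0: "x \<noteq> 0" for x
  proof -
    obtain v where v: "v \<noteq> 0" "birkhoff_orthogonal N v x"
      using exists_birkhoff_orthogonal[OF N x0] .
    have Nv: "N (A v) > 0" using is_norm_pos[OF N Anz[OF v(1)]] .
    have "\<bar>area v x\<bar> = k * N v * N x"
      using symplectic_dual_orthogonal[OF N v(2,1)] k(2)[OF x0] is_norm_pos[OF N v(1)]
      by (simp add: field_simps)
    \<comment> \<open>\<open>A v\<close> attains the dual norm of \<open>x\<close> for \<open>B\<close>, because \<open>A (A v) = - v\<close>\<close>
    moreover have "area x (A (A v)) = area v x" by (simp add: AA area_def)
    ultimately have "\<bar>B x (A v)\<bar> = l * N x * N (A v)"
      by (simp add: B_def l_def abs_divide inv mult_ac)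
    then have "(l * N x * N (A v))\<^sup>2 \<le> B x x * B (A v) (A v)"
      using inner_product_cauchy_schwarz[OF B, of x "A v"] by (metis power2_abs)
    also have "\<dots> \<le> B x x * (l * (N (A v))\<^sup>2)"
      using upper B x0 by (intro mult_left_mono) (auto simp: is_inner_product_def less_imp_le)
    finally have "(l * (N x)\<^sup>2) * (l * (N (A v))\<^sup>2) \<le> B x x * (l * (N (A v))\<^sup>2)"
      by (simp add: power2_eq_square mult_ac)
    then show ?thesis using l Nv by (simp add: mult.commute)
  qed
  have "N x = sqrt (1 / l * B x x)" for x
  proof -
    have "B x x = l * (N x)\<^sup>2"
    proof (cases "x = 0")
      case True
      then show ?thesis using is_norm_eq_zero[OF N, of 0] by (simp add: B_def area_def)
    next
      case False
      then show ?thesis using upper lower by (simp add: order_antisym)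
    qed
    then show ?thesis using l is_norm_nonneg[OF N] by simp
  qed
  moreover have "is_inner_product (\<lambda>x y. 1 / l * B x y)"
    using inner_product_scale[OF B, of "1 / l"] l by simp
  ultimately show ?thesis unfolding euclidean_norm_def by blast
qed

end
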